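(* Let $\Phi$ be a field of characteristic $3$, let $n\ge1$, and consider the $J$-ternary algebra $\mathcal{O}=\mathcal{O}(1;\underline n)$ over $\Phi$ with trilinear product $(f,g,h)\mapsto fg\,\partial(h)-hg\,\partial(f)$. Its associated Jordan algebra $J$ is isomorphic to the associative algebra $\mathcal{O}$ endowed with the ordinary Jordan product $x\bullet y=\frac{xy+yx}{2}$. Moreover, this algebra is not simple.
   Context: $\mathcal{O}=\mathcal{O}(1;\underline n)$ is the divided power algebra over $\Phi$ with basis $x^{(i)}$, $0\le i<3^n$, and product $x^{(i)}x^{(j)}=\binom{i+j}{i}x^{(i+j)}$ (with $x^{(k)}=0$ for $k\ge3^n$). The derivation $\partial$ of $\mathcal{O}$ is given by $\partial(x^{(i)})=x^{(i-1)}$ for $i\ge1$ and $\partial(x^{(0)})=0$. A $J$-ternary algebra is a vector space $X$ with a trilinear map $(x,y,z)\mapsto xyz$ such that for all $x,y,z,u,v,w\in X$: (1) $xy(uvw)-uv(xyw)=(xyu)vw+u(yxv)w$; (2) $xyz-zyx=zxy-xzy$. For such $X$ define operators $\langle x,z\rangle\in\mathrm{End}(X)$ by $\langle x,z\rangle y=zyx-xyz$. The associated Jordan algebra $J$ is the linear span in $\mathrm{End}(X)$ of all $\langle x,z\rangle$, $x,z\in X$, with product $(a\bullet b)x=\frac{a(b(x))+b(a(x))}{2}$ for $a,b\in J$, $x\in X$. The space $\mathcal{O}$ with the trilinear product above is a $J$-ternary algebra. *)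

theory Defs
  imports
    "HOL-Library.Function_Algebras"
    "HOL-Computational_Algebra.Computational_Algebra"
begin

(* Algebraic structures live on a subspace of an ambient vector space type; the ambient addition
   on function types is pointwise (Function_Algebras).  The pointwise multiplication of functions
   from that theory is never used. *)

section \<open>Algebras that need not be associative\<close>

locale nonassoc_algebra = vector_space scale
  for scale :: "'k::field \<Rightarrow> 'v::ab_group_add \<Rightarrow> 'v"
    and A :: "'v set"
    and mult :: "'v \<Rightarrow> 'v \<Rightarrow> 'v" +
  assumes subspace_carrier: "subspace A"
    and mult_closed: "\<lbrakk>a \<in> A; b \<in> A\<rbrakk> \<Longrightarrow> mult a b \<in> A"
    and mult_add_left: "\<lbrakk>a \<in> A; b \<in> A; c \<in> A\<rbrakk> \<Longrightarrow> mult (a + b) c = mult a c + mult b c"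
    and mult_add_right: "\<lbrakk>a \<in> A; b \<in> A; c \<in> A\<rbrakk> \<Longrightarrow> mult a (b + c) = mult a b + mult a c"
    and mult_scale_left: "\<lbrakk>a \<in> A; b \<in> A\<rbrakk> \<Longrightarrow> mult (scale r a) b = scale r (mult a b)"
    and mult_scale_right: "\<lbrakk>a \<in> A; b \<in> A\<rbrakk> \<Longrightarrow> mult a (scale r b) = scale r (mult a b)"

definition algebra_isomorphic ::
  "('k::field \<Rightarrow> 'v::ab_group_add \<Rightarrow> 'v) \<Rightarrow> 'v set \<Rightarrow> ('v \<Rightarrow> 'v \<Rightarrow> 'v) \<Rightarrow>
   ('k \<Rightarrow> 'w::ab_group_add \<Rightarrow> 'w) \<Rightarrow> 'w set \<Rightarrow> ('w \<Rightarrow> 'w \<Rightarrow> 'w) \<Rightarrow> bool"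
  where
  "algebra_isomorphic s A m s' B m' \<longleftrightarrow>
     nonassoc_algebra s A m \<and> nonassoc_algebra s' B m' \<and>
     (\<exists>\<phi>. bij_betw \<phi> A B \<and>
        (\<forall>a\<in>A. \<forall>b\<in>A. \<phi> (a + b) = \<phi> a + \<phi> b) \<and>
        (\<forall>r. \<forall>a\<in>A. \<phi> (s r a) = s' r (\<phi> a)) \<and>
        (\<forall>a\<in>A. \<forall>b\<in>A. \<phi> (m a b) = m' (\<phi> a) (\<phi> b)))"

definition algebra_ideal ::
  "('k::field \<Rightarrow> 'v::ab_group_add \<Rightarrow> 'v) \<Rightarrow> 'v set \<Rightarrow> ('v \<Rightarrow> 'v \<Rightarrow> 'v) \<Rightarrow> 'v set \<Rightarrow> bool"
  where
  "algebra_ideal s A m I \<longleftrightarrow>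
     module.subspace s I \<and> I \<subseteq> A \<and> (\<forall>a\<in>A. \<forall>i\<in>I. m a i \<in> I \<and> m i a \<in> I)"

definition simple_algebra ::
  "('k::field \<Rightarrow> 'v::ab_group_add \<Rightarrow> 'v) \<Rightarrow> 'v set \<Rightarrow> ('v \<Rightarrow> 'v \<Rightarrow> 'v) \<Rightarrow> bool"
  where
  "simple_algebra s A m \<longleftrightarrow>
     nonassoc_algebra s A m \<and> (\<exists>a\<in>A. \<exists>b\<in>A. m a b \<noteq> 0) \<and>
     (\<forall>I. algebra_ideal s A m I \<longrightarrow> I = {0} \<or> I = A)"

definition jordan_product ::
  "('k::field \<Rightarrow> 'v::ab_group_add \<Rightarrow> 'v) \<Rightarrow> ('v \<Rightarrow> 'v \<Rightarrow> 'v) \<Rightarrow> 'v \<Rightarrow> 'v \<Rightarrow> 'v"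
  where "jordan_product s m a b = s (1 / 2) (m a b + m b a)"

section \<open>J-ternary algebras and their associated Jordan algebras\<close>

locale J_ternary_algebra = vector_space scale
  for scale :: "'k::field \<Rightarrow> 'v::ab_group_add \<Rightarrow> 'v"
    and X :: "'v set"
    and tri :: "'v \<Rightarrow> 'v \<Rightarrow> 'v \<Rightarrow> 'v" +
  assumes subspace_X: "subspace X"
    and tri_closed: "\<lbrakk>x \<in> X; y \<in> X; z \<in> X\<rbrakk> \<Longrightarrow> tri x y z \<in> X"
    and tri_add1: "\<lbrakk>x \<in> X; x' \<in> X; y \<in> X; z \<in> X\<rbrakk> \<Longrightarrow> tri (x + x') y z = tri x y z + tri x' y z"
    and tri_add2: "\<lbrakk>x \<in> X; y \<in> X; y' \<in> X; z \<in> X\<rbrakk> \<Longrightarrow> tri x (y + y') z = tri x y z + tri x y' z"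
    and tri_add3: "\<lbrakk>x \<in> X; y \<in> X; z \<in> X; z' \<in> X\<rbrakk> \<Longrightarrow> tri x y (z + z') = tri x y z + tri x y z'"
    and tri_scale1: "\<lbrakk>x \<in> X; y \<in> X; z \<in> X\<rbrakk> \<Longrightarrow> tri (scale r x) y z = scale r (tri x y z)"
    and tri_scale2: "\<lbrakk>x \<in> X; y \<in> X; z \<in> X\<rbrakk> \<Longrightarrow> tri x (scale r y) z = scale r (tri x y z)"
    and tri_scale3: "\<lbrakk>x \<in> X; y \<in> X; z \<in> X\<rbrakk> \<Longrightarrow> tri x y (scale r z) = scale r (tri x y z)"
    and JT1: "\<lbrakk>x \<in> X; y \<in> X; u \<in> X; v \<in> X; w \<in> X\<rbrakk> \<Longrightarrow>
      tri x y (tri u v w) - tri u v (tri x y w) = tri (tri x y u) v w + tri u (tri y x v) w"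
    and JT2: "\<lbrakk>x \<in> X; y \<in> X; z \<in> X\<rbrakk> \<Longrightarrow>
      tri x y z - tri z y x = tri z x y - tri x z y"

(* An endomorphism of the subspace X is represented by its extension by zero to the ambient type.
   Thus the representing functions form a vector space under the pointwise operations, and
   composition of functions represents composition of endomorphisms. *)

definition op_scale :: "('k \<Rightarrow> 'v \<Rightarrow> 'v) \<Rightarrow> 'k \<Rightarrow> ('v \<Rightarrow> 'v) \<Rightarrow> 'v \<Rightarrow> 'v"
  where "op_scale s r a = (\<lambda>x. s r (a x))"

definition ternary_op ::
  "'v::ab_group_add set \<Rightarrow> ('v \<Rightarrow> 'v \<Rightarrow> 'v \<Rightarrow> 'v) \<Rightarrow> 'v \<Rightarrow> 'v \<Rightarrow> 'v \<Rightarrow> 'v"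
  where "ternary_op X tri x z = (\<lambda>y. if y \<in> X then tri z y x - tri x y z else 0)"

definition assoc_jordan_carrier ::
  "('k::field \<Rightarrow> 'v::ab_group_add \<Rightarrow> 'v) \<Rightarrow> 'v set \<Rightarrow> ('v \<Rightarrow> 'v \<Rightarrow> 'v \<Rightarrow> 'v) \<Rightarrow> ('v \<Rightarrow> 'v) set"
  where
  "assoc_jordan_carrier s X tri =
     module.span (op_scale s) {ternary_op X tri x z | x z. x \<in> X \<and> z \<in> X}"

definition assoc_jordan_mult ::
  "('k::field \<Rightarrow> 'v::ab_group_add \<Rightarrow> 'v) \<Rightarrow> ('v \<Rightarrow> 'v) \<Rightarrow> ('v \<Rightarrow> 'v) \<Rightarrow> 'v \<Rightarrow> 'v"
  where "assoc_jordan_mult s = jordan_product (op_scale s) (\<circ>)"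

section \<open>The divided power algebra in one variable\<close>

(* An element is represented by its coefficient sequence with respect to the basis x^(i),
   i < 3 ^ n; the multiplication is the bilinear extension of
   x^(i) x^(j) = binom(i+j, i) x^(i+j), see dp_mult_basis below. *)

definition dp_carrier :: "nat \<Rightarrow> (nat \<Rightarrow> 'a::field) set"
  where "dp_carrier n = {f. \<forall>i\<ge>3 ^ n. f i = 0}"

definition dp_scale :: "'a::field \<Rightarrow> (nat \<Rightarrow> 'a) \<Rightarrow> nat \<Rightarrow> 'a"
  where "dp_scale c f = (\<lambda>i. c * f i)"

definition dp_basis :: "nat \<Rightarrow> nat \<Rightarrow> 'a::field"
  where "dp_basis i = (\<lambda>k. if k = i then 1 else 0)"

definition dp_mult :: "nat \<Rightarrow> (nat \<Rightarrow> 'a::field) \<Rightarrow> (nat \<Rightarrow> 'a) \<Rightarrow> nat \<Rightarrow> 'a"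
  where "dp_mult n f g =
    (\<lambda>k. if k < 3 ^ n then \<Sum>i=0..k. of_nat (k choose i) * f i * g (k - i) else 0)"

definition dp_deriv :: "(nat \<Rightarrow> 'a::field) \<Rightarrow> nat \<Rightarrow> 'a"
  where "dp_deriv f = (\<lambda>i. f (Suc i))"

definition dp_tri ::
  "nat \<Rightarrow> (nat \<Rightarrow> 'a::field) \<Rightarrow> (nat \<Rightarrow> 'a) \<Rightarrow> (nat \<Rightarrow> 'a) \<Rightarrow> nat \<Rightarrow> 'a"
  where "dp_tri n f g h =
    dp_mult n (dp_mult n f g) (dp_deriv h) - dp_mult n (dp_mult n h g) (dp_deriv f)"

lemma dp_mult_basis:
  assumes "i < 3 ^ n" "j < 3 ^ n"
  shows "dp_mult n (dp_basis i) (dp_basis j :: nat \<Rightarrow> 'a::field) =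
    (if i + j < 3 ^ n then dp_scale (of_nat (i + j choose i)) (dp_basis (i + j)) else 0)"
proof -
  have *: "(\<Sum>l=0..k. of_nat (k choose l) * dp_basis i l * (dp_basis j (k - l) :: 'a)) =
      (if k = i + j then of_nat (k choose i) else 0)" for k
  proof -
    have "(\<Sum>l=0..k. of_nat (k choose l) * dp_basis i l * (dp_basis j (k - l) :: 'a)) =
       (\<Sum>l=0..k. if l = i then (if k = i + j then of_nat (k choose i) else 0) else 0)"
      by (intro sum.cong) (auto simp: dp_basis_def)
    then show ?thesis by (auto simp: sum.delta)
  qed
  show ?thesis
    by (rule ext) (auto simp: dp_mult_def * dp_scale_def, auto simp: dp_basis_def)
qed

lemma dp_deriv_basis:
  "dp_deriv (dp_basis 0 :: nat \<Rightarrow> 'a::field) = 0"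
  "dp_deriv (dp_basis (Suc i) :: nat \<Rightarrow> 'a::field) = dp_basis i"
  by (auto simp: dp_deriv_def dp_basis_def fun_eq_iff)

section \<open>The divided power algebra is a J-ternary algebra\<close>

lemma vector_space_dp: "vector_space (dp_scale :: 'a::field \<Rightarrow> _)"
  by unfold_locales (auto simp: dp_scale_def fun_eq_iff algebra_simps)

lemma vector_space_op:
  assumes "vector_space s"
  shows "vector_space (op_scale s)"
proof -
  interpret vector_space s by fact
  show ?thesis
    by unfold_locales
      (auto simp: op_scale_def fun_eq_iff scale_right_distrib scale_left_distrib)
qed

lemma dp_mult_comm: "dp_mult n f g = dp_mult n g (f :: nat \<Rightarrow> 'a::field)"
proof (rule ext)
  fix k
  have "(\<Sum>i=0..k. of_nat (k choose i) * f i * g (k - i)) =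
        (\<Sum>i=0..k. of_nat (k choose i) * g i * f (k - i))"
    by (rule sum.reindex_bij_witness[where i = "\<lambda>i. k - i" and j = "\<lambda>i. k - i"])
      (auto simp: binomial_symmetric[symmetric] mult_ac)
  then show "dp_mult n f g k = dp_mult n g f k" by (simp add: dp_mult_def)
qed

lemma dp_mult_assoc:
  "dp_mult n (dp_mult n f g) h = dp_mult n f (dp_mult n g (h :: nat \<Rightarrow> 'a::field))"
proof (rule ext)
  fix k
  have eq: "of_nat (k choose j) * (of_nat (j choose i) :: 'a) =
      of_nat (k choose i) * of_nat (k - i choose (j - i))" if "i \<le> j" "j \<le> k" for i j
    using choose_mult[OF that] by (metis of_nat_mult)
  define T where "T a b c = of_nat (k choose a) * of_nat (k - a choose b) * f a * g b * h c" for a b c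
  have 1: "(\<Sum>j=0..k. of_nat (k choose j) * (\<Sum>i=0..j. of_nat (j choose i) * f i * g (j - i)) * h (k - j))
      = (\<Sum>j=0..k. \<Sum>i=0..j. T i (j - i) (k - j))"
    unfolding sum_distrib_left sum_distrib_right T_def
    by (intro sum.cong refl) (simp add: eq[symmetric])
  have 2: "(\<Sum>j=0..k. of_nat (k choose j) * f j * (\<Sum>i=0..k - j. of_nat (k - j choose i) * g i * h (k - j - i)))
      = (\<Sum>j=0..k. \<Sum>i=0..k - j. T j i (k - j - i))"
    unfolding sum_distrib_left T_def by (intro sum.cong refl) (simp only: mult_ac)
  note eq = 1[unfolded fps_mult_assoc_lemma, folded 2]
  show "dp_mult n (dp_mult n f g) h k = dp_mult n f (dp_mult n g h) k"
  proof (cases "k < 3 ^ n")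
    case True
    then have "j < 3 ^ n" "k - j < 3 ^ n" if "j \<le> k" for j using that by auto
    then have "dp_mult n (dp_mult n f g) h k = (\<Sum>j=0..k. of_nat (k choose j) * (\<Sum>i=0..j. of_nat (j choose i) * f i * g (j - i)) * h (k - j))"
      "dp_mult n f (dp_mult n g h) k = (\<Sum>j=0..k. of_nat (k choose j) * f j * (\<Sum>i=0..k - j. of_nat (k - j choose i) * g i * h (k - j - i)))"
      using True by (simp_all add: dp_mult_def cong: sum.cong_simp)
    then show ?thesis using eq by simp
  qed (simp add: dp_mult_def)
qed

lemma dp_mult_add: "dp_mult n f (g + h) = dp_mult n f g + dp_mult n f (h :: nat \<Rightarrow> 'a::field)"
  by (rule ext) (simp add: dp_mult_def algebra_simps sum.distrib)

lemma dp_mult_add': "dp_mult n (g + h) f = dp_mult n g f + dp_mult n h (f :: nat \<Rightarrow> 'a::field)"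
  by (simp only: dp_mult_comm[of n _ f] dp_mult_add)

lemma dp_mult_diff: "dp_mult n f (g - h) = dp_mult n f g - dp_mult n f (h :: nat \<Rightarrow> 'a::field)"
  by (rule ext) (simp add: dp_mult_def algebra_simps sum_subtractf)

lemma dp_mult_diff': "dp_mult n (g - h) f = dp_mult n g f - dp_mult n h (f :: nat \<Rightarrow> 'a::field)"
  by (simp only: dp_mult_comm[of n _ f] dp_mult_diff)

lemma dp_mult_minus:
  "dp_mult n f (- g) = - dp_mult n f (g :: nat \<Rightarrow> 'a::field)"
  "dp_mult n (- g) f = - dp_mult n g (f :: nat \<Rightarrow> 'a::field)"
  by (rule ext, simp add: dp_mult_def sum_negf)+

lemma dp_mult_scale:
  "dp_mult n f (dp_scale c g) = dp_scale c (dp_mult n f (g :: nat \<Rightarrow> 'a::field))"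
  by (rule ext) (simp add: dp_mult_def dp_scale_def sum_distrib_left mult_ac)

lemma dp_mult_scale':
  "dp_mult n (dp_scale c g) f = dp_scale c (dp_mult n g (f :: nat \<Rightarrow> 'a::field))"
  by (simp only: dp_mult_comm[of n _ f] dp_mult_scale)

lemma dp_deriv_linear:
  "dp_deriv (f + g) = dp_deriv f + (dp_deriv g :: nat \<Rightarrow> 'a::field)"
  "dp_deriv (f - g) = dp_deriv f - (dp_deriv g :: nat \<Rightarrow> 'a::field)"
  "dp_deriv (dp_scale c g) = dp_scale c (dp_deriv g)"
  by (auto simp: dp_deriv_def dp_scale_def)

lemma dp_mult_in_carrier: "dp_mult n f g \<in> dp_carrier n"
  by (auto simp: dp_carrier_def dp_mult_def)

lemma dp_deriv_in_carrier: "f \<in> dp_carrier n \<Longrightarrow> dp_deriv f \<in> dp_carrier n"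
  by (auto simp: dp_carrier_def dp_deriv_def)

lemma of_nat_choose_power3:
  assumes "CHAR('a::field) = 3" "0 < i" "i < 3 ^ n"
  shows "of_nat (3 ^ n choose i) = (0 :: 'a)"
proof -
  have p: "prime (3::nat)" by simp
  have "i * (3 ^ n choose i) = 3 ^ n * (3 ^ n - 1 choose (i - 1))"
    using assms times_binomial_minus1_eq[of i "3 ^ n"] by simp
  then have "3 ^ n dvd i * (3 ^ n choose i)" by simp
  moreover have "\<not> 3 ^ n dvd i" using assms by (auto dest: dvd_imp_le)
  ultimately have "\<not> coprime (3 ^ n) (3 ^ n choose i)"
    using coprime_dvd_mult_left_iff by blast
  then have "3 dvd (3 ^ n choose i)"
    using p by (meson coprime_power_left_iff prime_imp_coprime)
  then show ?thesis using assms(1) by (simp add: of_nat_eq_0_iff_char_dvd)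
qed

lemma dp_deriv_mult:
  assumes "CHAR('a::field) = 3"
    and f: "f \<in> dp_carrier n" and g: "g \<in> dp_carrier n"
  shows "dp_deriv (dp_mult n f g) =
    dp_mult n (dp_deriv f) g + dp_mult n f (dp_deriv g :: nat \<Rightarrow> 'a)"
proof (rule ext)
  fix k
  let ?S = "\<Sum>i=0..Suc k. of_nat (Suc k choose i) * f i * g (Suc k - i)"
  have pascal: "(\<Sum>i=0..k. of_nat (k choose i) * f (Suc i) * g (k - i)) +
      (\<Sum>i=0..k. of_nat (k choose i) * f i * g (Suc (k - i))) = ?S"
  proof -
    have "(\<Sum>i=0..k. of_nat (k choose i) * f i * g (Suc (k - i))) =
          (\<Sum>i=0..k. of_nat (k choose i) * f i * g (Suc k - i))"
      by (intro sum.cong) (auto simp: Suc_diff_le)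
    also have "\<dots> = (\<Sum>i=0..Suc k. of_nat (k choose i) * f i * g (Suc k - i))"
      by (simp add: binomial_eq_0)
    also have "\<dots> = f 0 * g (Suc k) +
        (\<Sum>i=0..k. of_nat (k choose Suc i) * f (Suc i) * g (k - i))"
      by (subst sum.atLeast0_atMost_Suc_shift) simp
    finally have 1: "(\<Sum>i=0..k. of_nat (k choose i) * f i * g (Suc (k - i))) = \<dots>" .
    have "?S = f 0 * g (Suc k) +
        (\<Sum>i=0..k. of_nat (Suc k choose Suc i) * f (Suc i) * g (k - i))"
      by (subst sum.atLeast0_atMost_Suc_shift) simp
    also have "\<dots> = (\<Sum>i=0..k. of_nat (k choose i) * f (Suc i) * g (k - i)) +
        (f 0 * g (Suc k) + (\<Sum>i=0..k. of_nat (k choose Suc i) * f (Suc i) * g (k - i)))"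
      by (simp add: sum.distrib distrib_right)
    finally show ?thesis by (simp only: 1)
  qed
  consider "Suc k < 3 ^ n" | "Suc k = 3 ^ n" | "k \<ge> 3 ^ n" by linarith
  then show "dp_deriv (dp_mult n f g) k =
      (dp_mult n (dp_deriv f) g + dp_mult n f (dp_deriv g)) k"
  proof cases
    case 1
    then show ?thesis using pascal by (simp add: dp_deriv_def dp_mult_def)
  next
    case 2
    have "?S = 0"
    proof (rule sum.neutral, rule ballI)
      fix i assume "i \<in> {0..Suc k}"
      moreover have "f (Suc k) = 0" "g (Suc k) = 0" using f g 2 by (auto simp: dp_carrier_def)
      ultimately show "of_nat (Suc k choose i) * f i * g (Suc k - i) = 0"
        using of_nat_choose_power3[OF assms(1), of i n] 2
        by (cases "i = 0"; cases "i = Suc k") auto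
    qed
    then show ?thesis using pascal 2 by (simp add: dp_deriv_def dp_mult_def)
  next
    case 3
    then show ?thesis by (simp add: dp_deriv_def dp_mult_def)
  qed
qed

lemma dp_mult_left_comm:
  "dp_mult n f (dp_mult n g h) = dp_mult n g (dp_mult n f (h :: nat \<Rightarrow> 'a::field))"
  unfolding dp_mult_assoc[symmetric] by (simp add: dp_mult_comm[of n f g])

theorem J_ternary_algebra_dp:
  assumes char: "CHAR('a::field) = 3"
  shows "J_ternary_algebra (dp_scale :: 'a \<Rightarrow> _) (dp_carrier n) (dp_tri n)"
proof -
  interpret vector_space "dp_scale :: 'a \<Rightarrow> _" by (rule vector_space_dp)
  have three: "(3::'a) = 0" using of_nat_CHAR[where 'a='a] char by simp
  have sub: "subspace (dp_carrier n :: (nat \<Rightarrow> 'a) set)"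
    by (rule subspaceI) (auto simp: dp_carrier_def dp_scale_def)
  note L = dp_mult_minus dp_mult_add dp_mult_add' dp_mult_diff dp_mult_diff' dp_mult_scale dp_mult_scale'
    dp_deriv_linear
  note AC = dp_mult_assoc dp_mult_comm dp_mult_left_comm
  note C = dp_mult_in_carrier dp_deriv_in_carrier
  note D = dp_deriv_mult[OF char]
  show ?thesis
  proof
    show "subspace (dp_carrier n :: (nat \<Rightarrow> 'a) set)" by (rule sub)
  next
    fix x y z :: "nat \<Rightarrow> 'a"
    show "dp_tri n x y z \<in> dp_carrier n"
      unfolding dp_tri_def by (intro subspace_diff sub dp_mult_in_carrier)
  next
    fix x x' y z :: "nat \<Rightarrow> 'a"
    show "dp_tri n (x + x') y z = dp_tri n x y z + dp_tri n x' y z"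
      by (simp add: dp_tri_def L)
  next
    fix x y y' z :: "nat \<Rightarrow> 'a"
    show "dp_tri n x (y + y') z = dp_tri n x y z + dp_tri n x y' z"
      by (simp add: dp_tri_def L)
  next
    fix x y z z' :: "nat \<Rightarrow> 'a"
    show "dp_tri n x y (z + z') = dp_tri n x y z + dp_tri n x y z'"
      by (simp add: dp_tri_def L)
  next
    fix x y z :: "nat \<Rightarrow> 'a" and r
    show "dp_tri n (dp_scale r x) y z = dp_scale r (dp_tri n x y z)"
      "dp_tri n x (dp_scale r y) z = dp_scale r (dp_tri n x y z)"
      "dp_tri n x y (dp_scale r z) = dp_scale r (dp_tri n x y z)"
      by (simp_all add: dp_tri_def L scale_right_diff_distrib)
  next
    fix x y z :: "nat \<Rightarrow> 'a"
    assume "x \<in> dp_carrier n" "y \<in> dp_carrier n" "z \<in> dp_carrier n"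
    then show "dp_tri n x y z - dp_tri n z y x = dp_tri n z x y - dp_tri n x z y"
      by (simp add: dp_tri_def L D C AC) (rule ext, simp add: three algebra_simps)
  next
    fix x y u v w :: "nat \<Rightarrow> 'a"
    assume "x \<in> dp_carrier n" "y \<in> dp_carrier n" "u \<in> dp_carrier n"
      "v \<in> dp_carrier n" "w \<in> dp_carrier n"
    then show "dp_tri n x y (dp_tri n u v w) - dp_tri n u v (dp_tri n x y w) =
        dp_tri n (dp_tri n x y u) v w + dp_tri n u (dp_tri n y x v) w"
      by (simp add: dp_tri_def L D C AC)
  qed
qed

end

theory Submission
  imports Defs
begin

text \<open>
  Write \<open>q = 3 ^ n\<close> and \<open>L f\<close> for multiplication by \<open>f\<close>.  Since the product of \<open>\<O>\<close> is commutative and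
  associative, \<open>\<langle>x, z\<rangle> y = z y x - x y z\<close> collapses to \<open>2 (z \<partial>x - x \<partial>z) y\<close>, so every operator
  \<open>\<langle>x, z\<rangle>\<close> is the multiplication by twice the Wronskian of \<open>z\<close> and \<open>x\<close>
  (\<open>ternary_op_eq_left_mult\<close>).  The theorem then rests on the Wronskians spanning \<open>\<O>\<close>.  The
  Wronskians with \<open>1\<close> are the derivatives, which yield every \<open>x^(i)\<close> with \<open>i < q - 1\<close> but never the top
  element \<open>x^(q-1)\<close>.  That one is the Wronskian of \<open>x^(1)\<close> and \<open>x^(q-1)\<close>: its coefficient is
  \<open>(q - 1) - 1 = q - 2\<close>, and this is \<open>1\<close> in characteristic \<open>3\<close>, because \<open>3\<close> divides \<open>q\<close>.  Here \<open>n \<ge> 1\<close>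
  matters; for \<open>n = 0\<close> the derivation and hence \<open>J\<close> vanish.

  Consequently \<open>J\<close> consists of all \<open>L f\<close> with \<open>f\<close> in \<open>\<O>\<close>.  As \<open>\<O>\<close> has a unit, evaluation at \<open>1\<close> is
  an inverse of \<open>L\<close>, and it carries composition to multiplication.  An isomorphism of algebras is also
  one of the symmetrised algebras (\<open>algebra_isomorphic_jordan\<close>), which gives the first claim.  The elements
  with zero constant coefficient form a proper nonzero ideal of \<open>\<O>\<close>, so \<open>\<O>\<close> is not simple; nor is
  \<open>J\<close>, because simplicity passes along isomorphisms (\<open>simple_algebra_isomorphic\<close>).
\<close>

section \<open>Isomorphisms of nonassociative algebras\<close>

lemma nonassoc_algebra_jordan:
  assumes "nonassoc_algebra s A m"
  shows "nonassoc_algebra s A (jordan_product s m)"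
proof -
  interpret nonassoc_algebra s A m by fact
  show ?thesis
  proof
    show "subspace A" by (rule subspace_carrier)
  next
    fix a b assume "a \<in> A" "b \<in> A"
    then show "jordan_product s m a b \<in> A"
      unfolding jordan_product_def
      by (intro subspace_scale subspace_add subspace_carrier mult_closed)
  next
    fix a b c assume "a \<in> A" "b \<in> A" "c \<in> A"
    then show "jordan_product s m (a + b) c = jordan_product s m a c + jordan_product s m b c"
      "jordan_product s m a (b + c) = jordan_product s m a b + jordan_product s m a c"
      by (simp_all add: jordan_product_def mult_add_left mult_add_right scale_right_distrib add_ac)
  next
    fix a b r assume "a \<in> A" "b \<in> A"
    then show "jordan_product s m (s r a) b = s r (jordan_product s m a b)"
      "jordan_product s m a (s r b) = s r (jordan_product s m a b)"
      by (simp_all add: jordan_product_def mult_scale_left mult_scale_right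
          scale_right_distrib mult.commute)
  qed
qed

lemma algebra_isomorphic_jordan:
  assumes "algebra_isomorphic s A m s' B m'"
  shows "algebra_isomorphic s A (jordan_product s m) s' B (jordan_product s' m')"
proof -
  from assms obtain \<phi> where alg: "nonassoc_algebra s A m" "nonassoc_algebra s' B m'"
    and \<phi>: "bij_betw \<phi> A B" "\<And>a b. a \<in> A \<Longrightarrow> b \<in> A \<Longrightarrow> \<phi> (a + b) = \<phi> a + \<phi> b"
      "\<And>r a. a \<in> A \<Longrightarrow> \<phi> (s r a) = s' r (\<phi> a)"
      "\<And>a b. a \<in> A \<Longrightarrow> b \<in> A \<Longrightarrow> \<phi> (m a b) = m' (\<phi> a) (\<phi> b)"
    unfolding algebra_isomorphic_def by blast
  interpret nonassoc_algebra s A m by fact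
  have "\<phi> (jordan_product s m a b) = jordan_product s' m' (\<phi> a) (\<phi> b)" if "a \<in> A" "b \<in> A" for a b
    using that by (simp add: jordan_product_def \<phi> mult_closed subspace_add[OF subspace_carrier])
  then show ?thesis
    unfolding algebra_isomorphic_def using alg \<phi>
    by (intro conjI exI[of _ \<phi>] nonassoc_algebra_jordan ballI allI) simp_all
qed

text \<open>Ideals of the target pull back to ideals of the source, and a bijection detects whether the
  pull-back is zero or everything.\<close>

lemma simple_algebra_isomorphic:
  assumes iso: "algebra_isomorphic s A m s' B m'" and simp: "simple_algebra s A m"
  shows "simple_algebra s' B m'"
proof -
  from iso obtain \<phi> where alg: "nonassoc_algebra s A m" "nonassoc_algebra s' B m'"
    and bij: "bij_betw \<phi> A B" and add: "\<And>a b. a \<in> A \<Longrightarrow> b \<in> A \<Longrightarrow> \<phi> (a + b) = \<phi> a + \<phi> b"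
    and scal: "\<And>r a. a \<in> A \<Longrightarrow> \<phi> (s r a) = s' r (\<phi> a)"
    and mult: "\<And>a b. a \<in> A \<Longrightarrow> b \<in> A \<Longrightarrow> \<phi> (m a b) = m' (\<phi> a) (\<phi> b)"
    unfolding algebra_isomorphic_def by blast
  interpret A: nonassoc_algebra s A m by fact
  interpret B: nonassoc_algebra s' B m' by fact
  have im: "\<phi> ` A = B" and inj: "inj_on \<phi> A" using bij by (auto simp: bij_betw_def)
  have A0: "0 \<in> A" by (rule A.subspace_0[OF A.subspace_carrier])
  have \<phi>0: "\<phi> 0 = 0" using scal[OF A0, of 0] by simp
  obtain a b where ab: "a \<in> A" "b \<in> A" "m a b \<noteq> 0"
    using simp by (auto simp: simple_algebra_def)
  then have "m' (\<phi> a) (\<phi> b) \<noteq> 0"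
    using inj_onD[OF inj, of "m a b" 0] A0 A.mult_closed \<phi>0 mult by auto
  then have nz: "\<exists>a\<in>B. \<exists>b\<in>B. m' a b \<noteq> 0" using ab im by blast
  have "I = {0} \<or> I = B" if "algebra_ideal s' B m' I" for I
  proof -
    from that have subI: "B.subspace I" and IB: "I \<subseteq> B"
      and ideal: "\<And>a i. a \<in> B \<Longrightarrow> i \<in> I \<Longrightarrow> m' a i \<in> I \<and> m' i a \<in> I"
      by (auto simp: algebra_ideal_def)
    define I' where "I' = {a \<in> A. \<phi> a \<in> I}"
    have "A.subspace I'"
      unfolding I'_def
      by (rule A.subspaceI)
        (auto simp: A0 \<phi>0 add scal B.subspace_0[OF subI] B.subspace_add[OF subI]
          B.subspace_scale[OF subI] A.subspace_add[OF A.subspace_carrier]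
          A.subspace_scale[OF A.subspace_carrier])
    then have "algebra_ideal s A m I'"
      unfolding algebra_ideal_def I'_def using ideal im by (auto simp: A.mult_closed mult)
    then have "I' = {0} \<or> I' = A" using simp by (auto simp: simple_algebra_def)
    moreover have "\<phi> ` I' = I" using IB im by (auto simp: I'_def)
    ultimately show ?thesis using im \<phi>0 by auto
  qed
  then show ?thesis unfolding simple_algebra_def using alg nz by blast
qed

section \<open>Multiplication operators of the divided power algebra\<close>

lemma subspace_dp_carrier:
  "module.subspace (dp_scale :: 'a::field \<Rightarrow> _) (dp_carrier n)"
proof -
  interpret vector_space "dp_scale :: 'a \<Rightarrow> _" by (rule vector_space_dp)
  show ?thesis by (rule subspaceI) (auto simp: dp_carrier_def dp_scale_def)
qed

lemma dp_basis_in_carrier: "i < 3 ^ n \<Longrightarrow> dp_basis i \<in> dp_carrier n"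
  by (auto simp: dp_carrier_def dp_basis_def)

lemma dp_mult_one:
  assumes "f \<in> dp_carrier n"
  shows "dp_mult n f (dp_basis 0) = (f :: nat \<Rightarrow> 'a::field)"
proof (rule ext)
  fix k
  have "(\<Sum>i=0..k. of_nat (k choose i) * f i * dp_basis 0 (k - i)) =
      (\<Sum>i=0..k. if i = k then f k else 0)"
    by (intro sum.cong) (auto simp: dp_basis_def)
  then show "dp_mult n f (dp_basis 0) k = f k"
    using assms by (auto simp: dp_mult_def dp_carrier_def)
qed

lemma nonassoc_algebra_dp:
  "nonassoc_algebra (dp_scale :: 'a::field \<Rightarrow> _) (dp_carrier n) (dp_mult n)"
proof -
  interpret vector_space "dp_scale :: 'a \<Rightarrow> _" by (rule vector_space_dp)
  show ?thesis
    by unfold_locales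
      (auto simp: subspace_dp_carrier dp_mult_in_carrier dp_mult_add dp_mult_add' dp_mult_scale
        dp_mult_scale')
qed

text \<open>The extension by zero outside \<open>\<O>\<close> is the convention by which \<^const>\<open>ternary_op\<close> represents
  endomorphisms.\<close>

definition dp_left_mult :: "nat \<Rightarrow> (nat \<Rightarrow> 'a::field) \<Rightarrow> (nat \<Rightarrow> 'a) \<Rightarrow> nat \<Rightarrow> 'a"
  where "dp_left_mult n f = (\<lambda>y. if y \<in> dp_carrier n then dp_mult n f y else 0)"

lemma dp_left_mult_add:
  "dp_left_mult n (f + g) = dp_left_mult n f + dp_left_mult n g"
  by (rule ext) (simp add: dp_left_mult_def dp_mult_add')

lemma dp_left_mult_scale:
  "dp_left_mult n (dp_scale c f) = op_scale dp_scale c (dp_left_mult n f)"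
  by (rule ext) (simp add: dp_left_mult_def dp_mult_scale' op_scale_def,
      simp add: dp_scale_def fun_eq_iff)

lemma dp_left_mult_comp:
  "dp_left_mult n f \<circ> dp_left_mult n g = dp_left_mult n (dp_mult n f g)"
proof (rule ext)
  fix y
  have "dp_mult n f 0 = 0" by (rule ext) (simp add: dp_mult_def)
  then show "(dp_left_mult n f \<circ> dp_left_mult n g) y = dp_left_mult n (dp_mult n f g) y"
    by (simp add: dp_left_mult_def dp_mult_in_carrier dp_mult_assoc)
qed

lemma dp_left_mult_one:
  "f \<in> dp_carrier n \<Longrightarrow> dp_left_mult n f (dp_basis 0) = f"
  by (simp add: dp_left_mult_def dp_mult_one dp_basis_in_carrier)

lemma subspace_dp_left_mult:
  "module.subspace (op_scale (dp_scale :: 'a::field \<Rightarrow> _)) (dp_left_mult n ` dp_carrier n)"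
proof -
  interpret O: vector_space "dp_scale :: 'a \<Rightarrow> _" by (rule vector_space_dp)
  interpret vector_space "op_scale (dp_scale :: 'a \<Rightarrow> _)"
    by (rule vector_space_op) (rule vector_space_dp)
  show ?thesis
  proof (rule subspaceI)
    have "dp_left_mult n (dp_scale (0::'a) 0) = 0"
      by (simp only: dp_left_mult_scale scale_zero_left)
    then show "(0 :: (nat \<Rightarrow> 'a) \<Rightarrow> nat \<Rightarrow> 'a) \<in> dp_left_mult n ` dp_carrier n"
      using O.subspace_0[OF subspace_dp_carrier] by (metis O.scale_zero_left image_eqI)
  qed (auto simp: dp_left_mult_add[symmetric] dp_left_mult_scale[symmetric]
      O.subspace_add[OF subspace_dp_carrier] O.subspace_scale[OF subspace_dp_carrier])
qed

lemma nonassoc_algebra_dp_left_mult: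
  "nonassoc_algebra (op_scale (dp_scale :: 'a::field \<Rightarrow> _)) (dp_left_mult n ` dp_carrier n) (\<circ>)"
proof -
  interpret vector_space "op_scale (dp_scale :: 'a \<Rightarrow> _)"
    by (rule vector_space_op) (rule vector_space_dp)
  show ?thesis
    by unfold_locales
      (auto simp: subspace_dp_left_mult dp_left_mult_comp dp_mult_in_carrier
        dp_left_mult_add[symmetric] dp_left_mult_scale[symmetric] dp_mult_add dp_mult_add'
        dp_mult_scale dp_mult_scale')
qed

text \<open>Evaluation at the unit recovers a multiplier from its multiplication operator.\<close>

lemma dp_left_mult_isomorphic:
  "algebra_isomorphic (op_scale (dp_scale :: 'a::field \<Rightarrow> _)) (dp_left_mult n ` dp_carrier n) (\<circ>)
     dp_scale (dp_carrier n) (dp_mult n)"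
proof -
  let ?ev = "\<lambda>a :: (nat \<Rightarrow> 'a) \<Rightarrow> nat \<Rightarrow> 'a. a (dp_basis 0)"
  have "bij_betw ?ev (dp_left_mult n ` dp_carrier n) (dp_carrier n)"
    by (rule bij_betw_byWitness[where f' = "dp_left_mult n"]) (auto simp: dp_left_mult_one)
  moreover have "?ev (a \<circ> b) = dp_mult n (?ev a) (?ev b)"
    if "a \<in> dp_left_mult n ` dp_carrier n" "b \<in> dp_left_mult n ` dp_carrier n" for a b
    using that by (auto simp: dp_left_mult_comp dp_left_mult_one dp_mult_in_carrier simp del: o_apply)
  ultimately show ?thesis
    unfolding algebra_isomorphic_def
    using nonassoc_algebra_dp nonassoc_algebra_dp_left_mult
    by (intro conjI exI[of _ ?ev]) (auto simp: op_scale_def)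
qed

section \<open>The associated Jordan algebra\<close>

definition dp_wronskian :: "nat \<Rightarrow> (nat \<Rightarrow> 'a::field) \<Rightarrow> (nat \<Rightarrow> 'a) \<Rightarrow> nat \<Rightarrow> 'a"
  where "dp_wronskian n f g = dp_mult n f (dp_deriv g) - dp_mult n g (dp_deriv f)"

lemma ternary_op_eq_left_mult:
  fixes x z :: "nat \<Rightarrow> 'a::field"
  shows "ternary_op (dp_carrier n) (dp_tri n) x z = dp_left_mult n (dp_scale 2 (dp_wronskian n z x))"
proof (rule ext)
  fix y :: "nat \<Rightarrow> 'a"
  have *: "dp_mult n (dp_mult n f y) g = dp_mult n (dp_mult n f g) y" for f g :: "nat \<Rightarrow> 'a"
    by (simp add: dp_mult_assoc dp_mult_comm dp_mult_left_comm)
  show "ternary_op (dp_carrier n) (dp_tri n) x z y =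
      dp_left_mult n (dp_scale 2 (dp_wronskian n z x)) y"
    unfolding ternary_op_def dp_left_mult_def dp_tri_def dp_wronskian_def *
      dp_mult_scale' dp_mult_diff'
    by (auto simp: dp_scale_def fun_eq_iff algebra_simps)
qed

lemma dp_wronskian_one:
  assumes "f \<in> dp_carrier n"
  shows "dp_wronskian n (dp_basis 0) f = dp_deriv f"
proof -
  have "dp_mult n f 0 = 0" by (rule ext) (simp add: dp_mult_def)
  then show ?thesis
    using dp_mult_one[OF dp_deriv_in_carrier[OF assms]]
    by (simp add: dp_wronskian_def dp_deriv_basis dp_mult_comm[of n "dp_basis 0"])
qed

text \<open>With \<open>q = 3 ^ n\<close>, the first term \<open>x^(1) x^(q-2)\<close> is \<open>(q-1) x^(q-1)\<close> and the second,
  \<open>x^(q-1) x^(0)\<close>, takes one copy of \<open>x^(q-1)\<close> away.  The remaining coefficient \<open>q - 2\<close> is \<open>1\<close> in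
  characteristic \<open>3\<close>.\<close>

lemma dp_wronskian_top:
  assumes char: "CHAR('a::field) = 3" and n: "n \<ge> 1"
  shows "dp_wronskian n (dp_basis 1) (dp_basis (3 ^ n - 1)) =
    (dp_basis (3 ^ n - 1) :: nat \<Rightarrow> 'a)"
proof -
  have "(3::nat) ^ 1 \<le> 3 ^ n" using n by (intro power_increasing) auto
  then obtain m where m: "(3::nat) ^ n = m + 2"
    using le_Suc_ex[of 2 "3 ^ n"] by (auto simp: add.commute)
  have three: "(3::'a) = 0" using of_nat_CHAR[where 'a='a] char by simp
  have "of_nat (3 ^ n) = (0::'a)" using n by (simp add: three)
  then have "of_nat m + 2 = (0::'a)" by (simp add: m add.commute)
  then have "of_nat m + 3 = (1::'a)" by (simp add: algebra_simps)
  then have coeff: "of_nat m = (1::'a)" by (simp add: three)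
  have "dp_mult n (dp_basis 1) (dp_basis m) =
      dp_scale (of_nat (Suc m)) (dp_basis (Suc m) :: nat \<Rightarrow> 'a)"
    using dp_mult_basis[of 1 n m, where 'a='a] by (simp add: m)
  moreover have "dp_mult n (dp_basis (Suc m)) (dp_basis 0) = (dp_basis (Suc m) :: nat \<Rightarrow> 'a)"
    by (intro dp_mult_one dp_basis_in_carrier) (simp add: m)
  ultimately show ?thesis
    by (auto simp: dp_wronskian_def dp_deriv_basis m dp_scale_def fun_eq_iff coeff algebra_simps)
qed

text \<open>Only the top coefficient obstructs integration.\<close>

lemma dp_carrier_deriv_decomposition:
  assumes "f \<in> dp_carrier n"
  obtains h where "h \<in> dp_carrier n"
    and "f = dp_deriv h + dp_scale (f (3 ^ n - 1)) (dp_basis (3 ^ n - 1))"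
proof
  let ?h = "\<lambda>i. if 0 < i \<and> i < 3 ^ n then f (i - 1) else 0"
  show "?h \<in> dp_carrier n" by (auto simp: dp_carrier_def)
  have "f i = 0" if "\<not> Suc i < 3 ^ n" "i \<noteq> 3 ^ n - 1" for i
    using assms that by (auto simp: dp_carrier_def)
  then show "f = dp_deriv ?h + dp_scale (f (3 ^ n - 1)) (dp_basis (3 ^ n - 1))"
    by (auto simp: fun_eq_iff dp_deriv_def dp_scale_def dp_basis_def)
qed

lemma assoc_jordan_carrier_dp:
  assumes char: "CHAR('a::field) = 3" and n: "n \<ge> 1"
  shows "assoc_jordan_carrier (dp_scale :: 'a \<Rightarrow> _) (dp_carrier n) (dp_tri n) =
    dp_left_mult n ` dp_carrier n"
proof -
  interpret O: vector_space "dp_scale :: 'a \<Rightarrow> _" by (rule vector_space_dp)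
  interpret vector_space "op_scale (dp_scale :: 'a \<Rightarrow> _)"
    by (rule vector_space_op) (rule vector_space_dp)
  let ?T = "ternary_op (dp_carrier n) (dp_tri n) :: (nat \<Rightarrow> 'a) \<Rightarrow> _"
  let ?S = "{?T x z | x z. x \<in> dp_carrier n \<and> z \<in> dp_carrier n}"
  have "?S \<subseteq> dp_left_mult n ` dp_carrier n"
    by (auto simp: ternary_op_eq_left_mult dp_wronskian_def intro!: imageI
        O.subspace_scale O.subspace_diff subspace_dp_carrier dp_mult_in_carrier)
  then have "span ?S \<subseteq> dp_left_mult n ` dp_carrier n"
    by (rule span_minimal) (rule subspace_dp_left_mult)
  moreover have "dp_left_mult n ` dp_carrier n \<subseteq> span ?S"
  proof (intro image_subsetI)
    \<comment> \<open>The factor \<open>2\<close> in \<open>ternary_op_eq_left_mult\<close> is its own inverse.\<close>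
    have "(3::'a) = 0" using of_nat_CHAR[where 'a='a] char by simp
    moreover have "2 * 2 = (1::'a) + 3" by simp
    ultimately have four: "2 * 2 = (1::'a)" by (simp only: add_0_right)
    have wronskian: "dp_left_mult n (dp_wronskian n z x) \<in> span ?S"
      if "x \<in> dp_carrier n" "z \<in> dp_carrier n" for x z
    proof -
      have "dp_left_mult n (dp_wronskian n z x) = op_scale dp_scale 2 (?T x z)"
        by (simp only: ternary_op_eq_left_mult dp_left_mult_scale scale_scale four scale_one)
      also have "\<dots> \<in> span ?S" using that by (intro span_scale span_base) blast
      finally show ?thesis .
    qed
    fix f :: "nat \<Rightarrow> 'a" assume "f \<in> dp_carrier n"
    then obtain h where h: "h \<in> dp_carrier n"
      and f: "f = dp_deriv h + dp_scale (f (3 ^ n - 1)) (dp_basis (3 ^ n - 1))"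
      by (rule dp_carrier_deriv_decomposition)
    have "1 < (3::nat) ^ n" using n by (intro one_less_power) auto
    then have "dp_left_mult n (dp_basis (3 ^ n - 1) :: nat \<Rightarrow> 'a) \<in> span ?S"
      using wronskian[of "dp_basis (3 ^ n - 1)" "dp_basis 1"] dp_wronskian_top[OF char n]
      by (simp add: dp_basis_in_carrier)
    moreover have "dp_left_mult n (dp_deriv h) \<in> span ?S"
      using wronskian[OF h, of "dp_basis 0"] dp_wronskian_one[OF h]
      by (simp add: dp_basis_in_carrier)
    ultimately show "dp_left_mult n f \<in> span ?S"
      by (subst f) (simp only: dp_left_mult_add dp_left_mult_scale span_add span_scale)
  qed
  ultimately show ?thesis unfolding assoc_jordan_carrier_def by blast
qed

section \<open>The augmentation ideal\<close>

text \<open>The constant coefficient is multiplicative, so its kernel is an ideal; it omits \<open>1\<close> and, as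
  \<open>3 ^ n > 1\<close>, contains \<open>x^(1)\<close>.\<close>

lemma not_simple_dp:
  assumes "n \<ge> 1"
  shows "\<not> simple_algebra (dp_scale :: 'a::field \<Rightarrow> _) (dp_carrier n) (jordan_product dp_scale (dp_mult n))"
proof
  let ?O = "dp_carrier n :: (nat \<Rightarrow> 'a) set"
  let ?I = "{f \<in> ?O. f 0 = 0}"
  interpret nonassoc_algebra "dp_scale :: 'a \<Rightarrow> _" ?O "jordan_product dp_scale (dp_mult n)"
    by (intro nonassoc_algebra_jordan nonassoc_algebra_dp)
  assume simple: "simple_algebra dp_scale ?O (jordan_product dp_scale (dp_mult n))"
  have "subspace ?I"
    by (rule subspaceI) (auto simp: dp_carrier_def dp_scale_def)
  then have "algebra_ideal dp_scale ?O (jordan_product dp_scale (dp_mult n)) ?I"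
    unfolding algebra_ideal_def
    by (auto simp: mult_closed) (auto simp: jordan_product_def dp_scale_def dp_mult_def)
  then have "?I = {0} \<or> ?I = ?O" using simple by (auto simp: simple_algebra_def)
  moreover have "dp_basis 0 \<in> ?O - ?I"
    by (simp add: dp_basis_in_carrier) (simp add: dp_basis_def)
  moreover have "dp_basis 1 \<in> ?I - {0}"
  proof -
    have "1 < (3::nat) ^ n" using assms by (intro one_less_power) auto
    moreover have "dp_basis 1 \<noteq> (0 :: nat \<Rightarrow> 'a)"
      by (auto simp: dp_basis_def fun_eq_iff intro!: exI[of _ 1])
    ultimately show ?thesis by (simp add: dp_basis_in_carrier) (simp add: dp_basis_def)
  qed
  ultimately show False by blast
qed

theorem lemma3p4:
  fixes n :: nat
  assumes "CHAR('a::field) = 3" and "n \<ge> 1"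
  shows "algebra_isomorphic
           (op_scale (dp_scale :: 'a \<Rightarrow> (nat \<Rightarrow> 'a) \<Rightarrow> nat \<Rightarrow> 'a))
             (assoc_jordan_carrier dp_scale (dp_carrier n) (dp_tri n))
             (assoc_jordan_mult dp_scale)
           (dp_scale :: 'a \<Rightarrow> (nat \<Rightarrow> 'a) \<Rightarrow> nat \<Rightarrow> 'a)
             (dp_carrier n)
             (jordan_product dp_scale (dp_mult n))
      \<and> \<not> simple_algebra
           (op_scale (dp_scale :: 'a \<Rightarrow> (nat \<Rightarrow> 'a) \<Rightarrow> nat \<Rightarrow> 'a))
             (assoc_jordan_carrier dp_scale (dp_carrier n) (dp_tri n))
             (assoc_jordan_mult dp_scale)
      \<and> \<not> simple_algebra
           (dp_scale :: 'a \<Rightarrow> (nat \<Rightarrow> 'a) \<Rightarrow> nat \<Rightarrow> 'a)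
             (dp_carrier n)
             (jordan_product dp_scale (dp_mult n))"
proof -
  let ?J = "assoc_jordan_carrier (dp_scale :: 'a \<Rightarrow> _) (dp_carrier n) (dp_tri n)"
  have iso: "algebra_isomorphic (op_scale (dp_scale :: 'a \<Rightarrow> _)) ?J (assoc_jordan_mult dp_scale)
      dp_scale (dp_carrier n) (jordan_product dp_scale (dp_mult n))"
    unfolding assoc_jordan_mult_def assoc_jordan_carrier_dp[OF assms]
    by (intro algebra_isomorphic_jordan dp_left_mult_isomorphic)
  then show ?thesis
    using not_simple_dp[OF assms(2), where 'a='a] simple_algebra_isomorphic[OF iso] by blast
qed

end
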